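(* Let $q$ be an odd prime power. If $\mathcal{F}$ is a triangular subfamily of maximum size of the family $\mathbb{P}(q)$ of lines of the projective plane of order $q$ over $\mathbb{F}_q$, then $|\mathcal{F}|=q+1$.
   Context: Let $\mathbb{F}_q$ be the finite field of order $q$, let $\omega$ be a symbol not in $\mathbb{F}_q$, and let $V=((\mathbb{F}_q\cup\{\omega\})\times\mathbb{F}_q)\cup\{(\omega,\omega)\}$ be the set of points, $|V|=q^2+q+1$. The projective plane $\mathbb{P}(q)$ is viewed as the family of its lines $\{L_\alpha\mid\alpha\in V\}$, each a set of points, where - $L_{(m,b)}=\{(x,y)\in\mathbb{F}_q\times\mathbb{F}_q\mid y=mx+b\}\cup\{(\omega,m)\}$ for $(m,b)\in\mathbb{F}_q\times\mathbb{F}_q$; - $L_{(\omega,b)}=\{(b,y)\mid y\in\mathbb{F}_q\}\cup\{(\omega,\omega)\}$ for $b\in\mathbb{F}_q$; - $L_{(\omega,\omega)}=\{(\omega,y)\mid y\in\mathbb{F}_q\}\cup\{(\omega,\omega)\}$. A family $\mathcal{F}$ of sets is triangular if $A\cap B\cap C=\emptyset$ for every three distinct members $A,B,C\in\mathcal{F}$. *)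

theory Defs
  imports "HOL-Number_Theory.Prime_Powers" "HOL-Library.Cardinality"
begin

text \<open>
  The type \<open>'a option\<close> models the set obtained from the finite field \<open>'a\<close> by adjoining one
  further symbol, with \<open>None\<close> as the symbol \<open>\<omega>\<close> and \<open>Some x\<close> as the field element \<open>x\<close>.
\<close>

abbreviation omega :: "'a option" where
  "omega \<equiv> None"

definition points :: "('a option \<times> 'a option) set" where
  "points = (UNIV \<times> range Some) \<union> {(omega, omega)}"

text \<open>
  No equation is given for an index \<open>(Some m, omega)\<close>, since such a pair is not a point.
\<close>

fun line :: "'a::field option \<times> 'a option \<Rightarrow> ('a option \<times> 'a option) set" where
  "line (Some m, Some b) = {(Some x, Some y) | x y. y = m * x + b} \<union> {(omega, Some m)}"
| "line (omega, Some b) = {(Some b, Some y) | y. True} \<union> {(omega, omega)}"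
| "line (omega, omega) = {(omega, Some y) | y. True} \<union> {(omega, omega)}"

definition lines :: "('a::field option \<times> 'a option) set set" where
  "lines = {line \<alpha> | \<alpha>. \<alpha> \<in> points}"

definition triangular :: "'b set set \<Rightarrow> bool" where
  "triangular \<F> \<longleftrightarrow>
     (\<forall>A\<in>\<F>. \<forall>B\<in>\<F>. \<forall>C\<in>\<F>. A \<noteq> B \<and> A \<noteq> C \<and> B \<noteq> C \<longrightarrow> A \<inter> B \<inter> C = {})"

text \<open>
  Meant for a finite family \<open>\<P>\<close>, since \<open>card\<close> is \<open>0\<close> on infinite sets.
\<close>

definition max_triangular_subfamily :: "'b set set \<Rightarrow> 'b set set \<Rightarrow> bool" where
  "max_triangular_subfamily \<F> \<P> \<longleftrightarrow>
     \<F> \<subseteq> \<P> \<and> triangular \<F> \<and> (\<forall>\<G>. \<G> \<subseteq> \<P> \<and> triangular \<G> \<longrightarrow> card \<G> \<le> card \<F>)"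

end

theory Submission
  imports Defs
begin

text \<open>
  Lower bound: the lines \<open>y = m x + m\<^sup>2\<close> together with the line at infinity form a dual conic, since
  the slopes \<open>m\<close> of those through \<open>(x, y)\<close> are the roots of a quadratic.
  Upper bound: the lines of a triangular family meet any one member in distinct points, so
  there are at most \<open>q + 2\<close> of them. If there are \<open>q + 2\<close>, every point lies on \<open>0\<close> or \<open>2\<close> of them;
  a line outside the family meets each member once, so that \<open>q + 2\<close> is even.
\<close>

lemma lines_cases:
  assumes "A \<in> lines"
  obtains m b where "A = line (Some m, Some b)"
    | b where "A = line (omega, Some b)"
    | "A = line (omega, omega)"
proof -
  from assms obtain u v where "A = line (u, v)" "(u, v) \<in> points"
    by (auto simp: lines_def simp del: line.simps)
  then show ?thesis
    using that by (cases u) (auto simp: points_def simp del: line.simps)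
qed

lemma line_in_lines:
  "line (Some m, Some b) \<in> lines" "line (omega, Some b) \<in> lines" "line (omega, omega) \<in> lines"
  unfolding lines_def points_def by blast+

text \<open>Affine lines of equal slope \<open>m\<close> share only \<open>(omega, Some m)\<close>;
  distinct slopes give a linear equation for the abscissa. Existence feeds the upper bound by
  counting, uniqueness the parity argument.\<close>

lemma lines_meet_once:
  assumes "A \<in> lines" "B \<in> lines" "A \<noteq> B"
  shows "\<exists>!p. p \<in> A \<inter> B"
proof -
  have affine: "\<exists>!p. p \<in> line (Some m, Some b) \<inter> line (Some n, Some c)"
    if "line (Some m, Some b) \<noteq> line (Some n, Some c)" for m b n c :: 'a
  proof (cases "m = n")
    case True
    with that have "b \<noteq> c" by auto
    with True show ?thesis by auto
  next
    case False
    have iff: "m * x + b = n * x + c \<longleftrightarrow> x = (c - b) / (m - n)" for x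
      using False by (auto simp: field_simps)
    show ?thesis
    proof (rule ex1I[of _ "(Some ((c - b) / (m - n)), Some (m * ((c - b) / (m - n)) + b))"])
      show "(Some ((c - b) / (m - n)), Some (m * ((c - b) / (m - n)) + b))
          \<in> line (Some m, Some b) \<inter> line (Some n, Some c)"
        using iff[of "(c - b) / (m - n)"] by simp
    qed (use False iff in auto)
  qed
  show ?thesis
    using assms(1)
  proof (cases rule: lines_cases)
    case A: (1 m b)
    from assms(2) show ?thesis
      by (cases rule: lines_cases) (use A assms(3) affine in auto)
  next
    case A: (2 b)
    from assms(2) show ?thesis
      by (cases rule: lines_cases) (use A assms(3) in auto)
  next
    case A: 3
    from assms(2) show ?thesis
      by (cases rule: lines_cases) (use A assms(3) in auto)
  qed
qed

lemma card_in_lines: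
  fixes A :: "('a::{field,finite} option \<times> 'a option) set"
  assumes "A \<in> lines"
  shows "card A = CARD('a) + 1"
  using assms
proof (cases rule: lines_cases)
  case (1 m b)
  then have "A = insert (omega, Some m) (range (\<lambda>x. (Some x, Some (m * x + b))))" by auto
  moreover have "inj (\<lambda>x. (Some x, Some (m * x + b)))" by (auto intro: injI)
  ultimately show ?thesis by (simp add: card_insert_if card_image image_iff)
next
  case (2 b)
  then have "A = insert (omega, omega) (range (\<lambda>y::'a. (Some b, Some y)))" by auto
  moreover have "inj (\<lambda>y::'a. (Some b, Some y))" by (auto intro: injI)
  ultimately show ?thesis by (simp add: card_insert_if card_image image_iff)
next
  case 3
  then have "A = insert (omega, omega) (range (\<lambda>y. (omega, Some y)))" by auto
  moreover have "inj (\<lambda>y::'a. (omega :: 'a option, Some y))" by (auto intro: injI)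
  ultimately show ?thesis by (simp add: card_insert_if card_image image_iff)
qed

lemma triangularD:
  assumes "triangular \<F>" "A \<in> \<F>" "B \<in> \<F>" "C \<in> \<F>" "p \<in> A" "p \<in> B" "p \<in> C"
  shows "A = B \<or> A = C \<or> B = C"
  using assms unfolding triangular_def by blast

text \<open>In odd characteristic this is the tangent to the parabola \<open>y = - x * x / 4\<close>
  at \<open>x = - 2 * m\<close>.\<close>

definition tangent :: "'a::field \<Rightarrow> ('a option \<times> 'a option) set" where
  "tangent m = line (Some m, Some (m * m))"

lemma mem_tangent [simp]:
  "(Some x, Some y) \<in> tangent m \<longleftrightarrow> y = m * x + m * m"
  "(omega, Some n) \<in> tangent m \<longleftrightarrow> n = m"
  "(u, omega) \<notin> tangent m"
  by (auto simp: tangent_def)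

lemma inj_tangent: "inj tangent"
  by (metis injI mem_tangent(2))

text \<open>The line at infinity \<open>line (omega, omega)\<close> completes the family: it is the
  tangent to that parabola at its infinite point \<open>(omega, omega)\<close>.\<close>

definition dual_conic :: "('a::field option \<times> 'a option) set set" where
  "dual_conic = insert (line (omega, omega)) (range tangent)"

lemma dual_conic_subset: "dual_conic \<subseteq> lines"
  using line_in_lines by (auto simp: dual_conic_def tangent_def simp del: line.simps)

lemma card_dual_conic:
  "card (dual_conic :: ('a::{field,finite} option \<times> 'a option) set set) = CARD('a) + 1"
proof -
  have "(omega, omega) \<in> line (omega, omega)" by simp
  then have "line (omega, omega) \<notin> range (tangent :: 'a \<Rightarrow> _)"
    using mem_tangent(3) by (metis imageE)
  then show ?thesis
    by (simp add: dual_conic_def card_image[OF inj_tangent] del: line.simps)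
qed

text \<open>No point lies on three members: an affine point lies on at most two tangents,
  \<open>(omega, Some y)\<close> only on \<open>tangent y\<close> and the line at infinity, and
  \<open>(u, omega)\<close> on at most the line at infinity.\<close>

lemma triangular_dual_conic: "triangular (dual_conic :: ('a::field option \<times> 'a option) set set)"
proof -
  \<comment> \<open>If \<open>m\<close>, \<open>n\<close>, \<open>k\<close> were distinct, both \<open>n\<close> and \<open>k\<close> would equal \<open>- x - m\<close>.\<close>
  have roots: "m = n \<or> m = k \<or> n = k"
    if "m * x + m * m = n * x + n * n" "m * x + m * m = k * x + k * k" for m n k x :: 'a
  proof -
    have "(m - n) * (x + m + n) = 0" "(m - k) * (x + m + k) = 0"
      using that by (simp_all add: algebra_simps)
    then show ?thesis by (metis add_left_cancel eq_iff_diff_eq_0 mult_eq_0_iff)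
  qed
  define I :: "('a option \<times> 'a option) set" where "I = line (omega, omega)"
  have mem_I: "(Some x, v) \<notin> I" for x v
    by (auto simp: I_def)
  have cases: "A = I \<or> (\<exists>m. A = tangent m)" if "A \<in> dual_conic" for A :: "('a option \<times> 'a option) set"
    using that unfolding dual_conic_def I_def by blast
  have "A = B \<or> A = C \<or> B = C"
    if mem: "A \<in> dual_conic" "B \<in> dual_conic" "C \<in> dual_conic" and p: "p \<in> A" "p \<in> B" "p \<in> C"
    for A B C :: "('a option \<times> 'a option) set" and p
  proof -
    consider x y where "p = (Some x, Some y)" | y where "p = (omega, Some y)" | u where "p = (u, omega)"
      by (cases p; cases "fst p"; cases "snd p") auto
    then show ?thesis
    proof cases
      case (1 x y)
      then have "A \<noteq> I" "B \<noteq> I" "C \<noteq> I"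
        using p mem_I by auto
      then obtain m n k where ABC: "A = tangent m" "B = tangent n" "C = tangent k"
        using mem[THEN cases] by auto
      have "y = m * x + m * m" "y = n * x + n * n" "y = k * x + k * k"
        using p[unfolded 1 ABC mem_tangent] .
      then have "m = n \<or> m = k \<or> n = k"
        by (intro roots[of m x n k]) (rule trans, erule sym, assumption)+
      then show ?thesis using ABC by blast
    next
      case (2 y)
      have "D = I \<or> D = tangent y" if "D \<in> dual_conic" "p \<in> D" for D
        using cases[OF that(1)] that(2) 2 by auto
      then show ?thesis using mem p by metis
    next
      case (3 u)
      have "D = I" if "D \<in> dual_conic" "p \<in> D" for D
        using cases[OF that(1)] that(2) 3 by auto
      then show ?thesis using mem p by metis
    qed
  qed
  then show ?thesis unfolding triangular_def by blast
qed

text \<open>Send each other member to a point it shares with \<open>A\<close>. Two members with the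
  same image would form, with \<open>A\<close>, three members through one point, so this map into
  \<open>A\<close> is injective; the extra 1 counts \<open>A\<close> itself. In the case of equality
  the map is onto \<open>A\<close>.\<close>

lemma card_triangular:
  assumes "triangular \<F>" "finite \<F>" "A \<in> \<F>" "finite A"
    and meet: "\<And>B. B \<in> \<F> \<Longrightarrow> B \<noteq> A \<Longrightarrow> A \<inter> B \<noteq> {}"
  shows "card \<F> \<le> card A + 1"
    and "card \<F> = card A + 1 \<Longrightarrow> p \<in> A \<Longrightarrow> \<exists>B\<in>\<F>. B \<noteq> A \<and> p \<in> B"
proof -
  have "\<forall>B\<in>\<F> - {A}. \<exists>x. x \<in> A \<inter> B" using meet by blast
  from bchoice[OF this] obtain f where f: "\<And>B. B \<in> \<F> - {A} \<Longrightarrow> f B \<in> A \<inter> B" by blast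
  have inj: "inj_on f (\<F> - {A})"
  proof (rule inj_onI)
    fix B C assume *: "B \<in> \<F> - {A}" "C \<in> \<F> - {A}" "f B = f C"
    with f[of B] f[of C] show "B = C"
      using triangularD[OF assms(1), of A B C "f B"] assms(3) by auto
  qed
  have sub: "f ` (\<F> - {A}) \<subseteq> A" using f by auto
  have card: "card \<F> = card (f ` (\<F> - {A})) + 1"
    using card.remove[OF assms(2,3)] by (simp add: card_image[OF inj])
  show "card \<F> \<le> card A + 1" using card card_mono[OF assms(4) sub] by simp
  assume "card \<F> = card A + 1" "p \<in> A"
  then have "p \<in> f ` (\<F> - {A})" using card card_subset_eq[OF assms(4) sub] by simp
  then show "\<exists>B\<in>\<F>. B \<noteq> A \<and> p \<in> B" using f by auto
qed

text \<open>Grouping the members by the point where they meet \<open>L\<close> splits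
  \<open>\<F>\<close> into pairs.\<close>

lemma even_card_if_transversal:
  assumes "finite \<F>" "finite L"
    and once: "\<And>A. A \<in> \<F> \<Longrightarrow> \<exists>!p. p \<in> A \<inter> L"
    and two: "\<And>A p. A \<in> \<F> \<Longrightarrow> p \<in> A \<Longrightarrow> card {B \<in> \<F>. p \<in> B} = 2"
  shows "even (card \<F>)"
proof -
  \<comment> \<open>Points of \<open>L\<close> on no member are left out, since they would
    contribute an empty block.\<close>
  define \<C> where "\<C> = (\<lambda>p. {B \<in> \<F>. p \<in> B}) ` (L \<inter> \<Union>\<F>)"
  have "\<F> \<subseteq> \<Union>\<C>"
  proof
    fix A assume "A \<in> \<F>"
    moreover obtain p where "p \<in> A \<inter> L" using once[OF calculation] by blast
    ultimately show "A \<in> \<Union>\<C>" by (auto simp: \<C>_def)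
  qed
  then have union: "\<Union>\<C> = \<F>" by (auto simp: \<C>_def)
  have "2 * card \<C> = card (\<Union>\<C>)"
  proof (rule card_partition)
    show "finite \<C>" using assms(2) by (simp add: \<C>_def)
    show "finite (\<Union>\<C>)" using assms(1) union by simp
    show "card c = 2" if "c \<in> \<C>" for c using that two by (auto simp: \<C>_def)
    show "c \<inter> d = {}" if "c \<in> \<C>" "d \<in> \<C>" "c \<noteq> d" for c d
    proof -
      from that obtain p r where pr: "p \<in> L" "c = {B \<in> \<F>. p \<in> B}" "r \<in> L" "d = {B \<in> \<F>. r \<in> B}"
        by (auto simp: \<C>_def)
      with that(3) have "p \<noteq> r" by blast
      \<comment> \<open>A common member of both blocks would meet \<open>L\<close> in the two points
        \<open>p\<close> and \<open>r\<close>.\<close>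
      have False if "B \<in> \<F>" "p \<in> B" "r \<in> B" for B
        using once[OF that(1)] that pr(1,3) \<open>p \<noteq> r\<close> by blast
      then show ?thesis using pr by blast
    qed
  qed
  then show ?thesis using union by (metis dvd_triv_left)
qed

text \<open>Three lines pass through \<open>(omega, omega)\<close>, so one of them is missing. This
  supplies the transversal for the parity argument.\<close>

lemma triangular_omits_line:
  fixes \<F> :: "('a::field option \<times> 'a option) set set"
  assumes "triangular \<F>"
  obtains L where "L \<in> lines" "L \<notin> \<F>"
proof -
  let ?A = "line (omega, omega) :: ('a option \<times> 'a option) set"
  let ?B = "line (omega, Some 0) :: ('a option \<times> 'a option) set"
  let ?C = "line (omega, Some 1) :: ('a option \<times> 'a option) set"
  have "(omega, omega) \<in> ?A" "(omega, omega) \<in> ?B" "(omega, omega) \<in> ?C" by auto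
  \<comment> \<open>These two affine points tell the three lines apart.\<close>
  moreover have "(Some 0, Some 0) \<notin> ?A" "(Some 0, Some 0) \<in> ?B" "(Some 0, Some 0) \<notin> ?C"
    "(Some 1, Some 0) \<notin> ?A" "(Some 1, Some 0) \<in> ?C" by auto
  ultimately have "\<not> (?A \<in> \<F> \<and> ?B \<in> \<F> \<and> ?C \<in> \<F>)"
    using triangularD[OF assms, of ?A ?B ?C "(omega, omega)"] by metis
  then show ?thesis using that line_in_lines by metis
qed

lemma card_triangular_lines_le:
  fixes \<F> :: "('a::{field,finite} option \<times> 'a option) set set"
  assumes "odd CARD('a)" "\<F> \<subseteq> lines" "triangular \<F>"
  shows "card \<F> \<le> CARD('a) + 1"
proof (rule ccontr)
  assume "\<not> card \<F> \<le> CARD('a) + 1"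
  then have ge: "card \<F> \<ge> CARD('a) + 2" by simp
  have meet: "A \<inter> B \<noteq> {}" if "A \<in> \<F>" "B \<in> \<F>" "B \<noteq> A" for A B
    using lines_meet_once[of A B] that assms(2) by blast
  \<comment> \<open>All lines have the same size, so every member attains the bound, and each of its
    points lies on a second member.\<close>
  have eq: "card \<F> = card A + 1" if "A \<in> \<F>" for A
  proof (rule antisym)
    show "card \<F> \<le> card A + 1"
      by (rule card_triangular(1)[OF assms(3) finite that finite meet[OF that]])
    show "card A + 1 \<le> card \<F>"
      using ge card_in_lines[of A] that assms(2) by auto
  qed
  have two: "card {B \<in> \<F>. p \<in> B} = 2" if A: "A \<in> \<F>" "p \<in> A" for A p
  proof -
    obtain B where B: "B \<in> \<F>" "B \<noteq> A" "p \<in> B"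
      using card_triangular(2)[OF assms(3) finite A(1) finite meet[OF A(1)] eq[OF A(1)] A(2)]
      by blast
    \<comment> \<open>Triangularity excludes a third member through \<open>p\<close>.\<close>
    then have "{B \<in> \<F>. p \<in> B} = {A, B}"
      using A triangularD[OF assms(3)] by blast
    then show ?thesis using B by simp
  qed
  obtain L where L: "L \<in> lines" "L \<notin> \<F>" using triangular_omits_line[OF assms(3)] .
  have "even (card \<F>)"
  proof (rule even_card_if_transversal[of _ L])
    show "\<exists>!p. p \<in> A \<inter> L" if "A \<in> \<F>" for A
      using lines_meet_once[of A L] that L assms(2) by blast
  qed (use two in auto)
  moreover obtain A where "A \<in> \<F>" using ge by fastforce
  then have "card \<F> = CARD('a) + 2"
    using eq card_in_lines assms(2) by fastforce
  ultimately show False using assms(1) by simp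
qed

theorem theorem23:
  fixes q :: nat and \<F> :: "('a::{field,finite} option \<times> 'a option) set set"
  assumes "primepow q" and "odd q"
    and "CARD('a) = q"
    and "max_triangular_subfamily \<F> lines"
  shows "card \<F> = q + 1"
proof (rule antisym)
  show "card \<F> \<le> q + 1"
    using assms card_triangular_lines_le by (auto simp: max_triangular_subfamily_def)
  \<comment> \<open>Maximality of \<open>\<F>\<close> is applied to the dual conic.\<close>
  show "q + 1 \<le> card \<F>"
    using assms dual_conic_subset triangular_dual_conic card_dual_conic[where 'a = 'a]
    unfolding max_triangular_subfamily_def by (metis (no_types))
qed

end
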